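(* Let $\tau>0$ and $1<\sigma<2$ be real numbers. For every formal power series $\hat f=\sum_{p=0}^{\infty}c_pz^p\in\mathbb{C}[[z]]_{\{\mathbb{M}^{\tau,\sigma}\}}$ there exists a function $f$, holomorphic in $\mathbb{C}\setminus(-\infty,0]$, such that for every unbounded proper subsector $S$ of $\mathbb{C}\setminus(-\infty,0]$, $f$ admits $\hat f$ as its uniform $\{\mathbb{M}^{\tau,\sigma}\}$-asymptotic expansion in $S$.
   Context: $\mathbb{N}=\{1,2,\dots\}$ and $\mathbb{N}_0=\mathbb{N}\cup\{0\}$. The sequence $\mathbb{M}^{\tau,\sigma}=(M_p^{\tau,\sigma})_{p\in\mathbb{N}_0}$ is given by $M_0^{\tau,\sigma}=1$ and $M_p^{\tau,\sigma}=p^{\tau p^{\sigma}}$ for $p\ge 1$. For a sequence $\mathbb{M}=(M_p)_{p\in\mathbb{N}_0}$ of positive real numbers with $M_0=1$, $\mathbb{C}[[z]]_{\{\mathbb{M}\}}$ is the set of formal power series $\sum_{p\ge0}c_pz^p$ with complex coefficients for which there exists $A>0$ with $\sup_{p\in\mathbb{N}_0}\frac{|c_p|}{A^pM_p}<\infty$. All sectors have vertex at $0$. An unbounded sector $S$ is an unbounded proper subsector of $\mathbb{C}\setminus(-\infty,0]$ if $\overline{S}\subseteq(\mathbb{C}\setminus(-\infty,0])\cup\{0\}$. A function $f$ holomorphic in a sector $S$ admits $\hat f=\sum_{p\ge0}c_pz^p$ as its uniform $\{\mathbb{M}\}$-asymptotic expansion in $S$ if there exist $C,A>0$ such that for every $n\in\mathbb{N}_0$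 and every $z\in S$, $$\Big|f(z)-\sum_{p=0}^{n-1}c_pz^p\Big|\le CA^nM_n|z|^n .$$ *)

theory Defs
  imports
    "HOL-Analysis.Analysis"
    "HOL-Computational_Algebra.Formal_Power_Series"
begin

text \<open>The case distinction is needed because \<open>0 powr x = 0\<close> in HOL, whereas the sequence starts with 1.\<close>
definition M_seq :: "real \<Rightarrow> real \<Rightarrow> nat \<Rightarrow> real" where
  "M_seq \<tau> \<sigma> p = (if p = 0 then 1 else real p powr (\<tau> * real p powr \<sigma>))"

text \<open>\<open>\<complex>[[z]]\<^sub>{\<^sub>M\<^sub>}\<close>; boundedness above of the quotients expresses that their supremum is finite.\<close>
definition fps_class :: "(nat \<Rightarrow> real) \<Rightarrow> complex fps set" where
  "fps_class M = {F. \<exists>A>0. bdd_above (range (\<lambda>p. cmod (fps_nth F p) / (A ^ p * M p)))}"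

text \<open>Open sectors in the plane with vertex 0, which does not belong to the sector.
  The opening is at most \<open>2\<pi>\<close>, so that no sector overlaps itself.\<close>
definition unbounded_sector :: "complex set \<Rightarrow> bool" where
  "unbounded_sector S \<longleftrightarrow>
     (\<exists>a b. a < b \<and> b \<le> a + 2 * pi \<and>
        S = {complex_of_real r * cis \<theta> | r \<theta>. 0 < r \<and> a < \<theta> \<and> \<theta> < b})"

definition unbounded_proper_subsector :: "complex set \<Rightarrow> complex set \<Rightarrow> bool" where
  "unbounded_proper_subsector S T \<longleftrightarrow> unbounded_sector S \<and> closure S \<subseteq> T \<union> {0}"

definition has_uniform_asymptotic_expansion ::
    "(nat \<Rightarrow> real) \<Rightarrow> (complex \<Rightarrow> complex) \<Rightarrow> complex fps \<Rightarrow> complex set \<Rightarrow> bool" where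
  "has_uniform_asymptotic_expansion M f F S \<longleftrightarrow>
     f holomorphic_on S \<and>
     (\<exists>C>0. \<exists>A>0. \<forall>n. \<forall>z\<in>S.
        cmod (f z - (\<Sum>p<n. fps_nth F p * z ^ p)) \<le> C * A ^ n * M n * cmod z ^ n)"

end

theory Submission
  imports Defs "HOL-Complex_Analysis.Cauchy_Integral_Formula"
begin

text \<open>
  The function is a Ritt series: every monomial \<open>c\<^sub>p z\<^sup>p\<close> is multiplied by a holomorphic
  function \<open>\<chi>\<^sub>p\<close> that is small away from 0, so that the series converges, but so close to 1
  near 0 that no coefficient of the expansion changes. The choice is
  \<open>\<chi>\<^sub>p z = (1 - exp (-(b\<^sub>p z)\<^bsup>-1/2\<^esup>))\<^bsup>2p\<^esup>\<close> with \<open>b\<^sub>p = B \<lambda>\<^sub>p\<close> and a constant \<open>B\<close>,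
  where \<open>\<lambda>\<^sub>p = exp (\<phi>' p)\<close> for \<open>M\<^sub>p = exp (\<phi> p)\<close>, that is \<open>\<phi> t = \<tau> t\<^sup>\<sigma> ln t\<close>. The square root maps
  the slit plane to the right half plane, hence every estimate holds for all \<open>z\<close> in a sector
  and no case distinction on the size of \<open>z\<close> is left in the end.

  A term with \<open>p \<ge> n\<close> has to be bounded by \<open>M\<^sub>n |z|\<^sup>n\<close>. Since \<open>|1 - exp (-w)|\<close> is at most 2 and at most
  \<open>|w|\<close> in the right half plane, \<open>|z\<^sup>p \<chi>\<^sub>p z| \<le> 4\<^sup>p |z|\<^sup>n b\<^sub>p\<^bsup>n-p\<^esup>\<close>; it remains to know
  \<open>M\<^sub>p \<le> M\<^sub>n \<lambda>\<^sub>p\<^bsup>p-n\<^esup>\<close>, which says that \<open>\<phi>\<close> lies above its tangent at \<open>p\<close>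
  (lemma \<open>M_seq_tangent\<close>). A large \<open>B\<close> absorbs all geometric factors and leaves \<open>2\<^bsup>-p\<^esup>\<close>.

  For \<open>p < n = p + k\<close> the error \<open>c\<^sub>p z\<^sup>p (1 - \<chi>\<^sub>p z)\<close> counts. In a proper subsector the real part of
  \<open>w = (b\<^sub>p z)\<^bsup>-1/2\<^esup>\<close> is at least \<open>c |w|\<close>, and \<open>exp (-x) \<le> (2 k)! / x\<^bsup>2k\<^esup>\<close> turns the flatness
  of \<open>1 - \<chi>\<^sub>p\<close> into exactly \<open>k\<close> powers of \<open>b\<^sub>p |z|\<close>. What is needed is
  \<open>(2 k)! M\<^sub>p \<lambda>\<^sub>p\<^sup>k \<le> D\<^sup>n M\<^sub>n\<close> with a constant \<open>D\<close> (lemma \<open>M_seq_growth\<close>):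
  the distance of \<open>\<phi> n\<close> from the tangent at \<open>p\<close>
  must beat \<open>2 k ln (2 n)\<close> up to a multiple of \<open>n\<close>. As \<open>\<phi>'' \<ge> \<tau> n\<^bsup>\<sigma>-2\<^esup>\<close> on \<open>[1, n]\<close>, this distance is at
  least \<open>m k\<^sup>2\<close> with \<open>m = \<tau> n\<^bsup>\<sigma>-2\<^esup> / 2\<close>, and for \<open>l = ln (2 n)\<close> the inequality \<open>2 k l \<le> m k\<^sup>2 + l\<^sup>2 / m\<close> leaves a remainder
  of order \<open>n\<^bsup>2-\<sigma>\<^esup> (ln n)\<^sup>2\<close>. It is \<open>O(n)\<close> because \<open>\<sigma> > 1\<close>.

  Lemma \<open>borel_ritt_root_cutoff\<close> carries out the construction for all weight sequences with
  these two properties.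
\<close>

section \<open>Elementary estimates\<close>

lemma power_div_fact_le_exp:
  fixes x :: real
  assumes "0 \<le> x"
  shows "x ^ n / fact n \<le> exp x"
proof -
  have "(\<Sum>k\<in>{n}. x ^ k /\<^sub>R fact k) \<le> exp x"
    unfolding exp_def by (rule sum_le_suminf[OF summable_exp_generic]) (use assms in auto)
  then show ?thesis by (simp add: divide_inverse mult.commute)
qed

text \<open>The mean value inequality applies on the left half plane, which is convex and on which
  the derivative of \<open>exp\<close> is bounded by 1.\<close>
lemma norm_one_minus_exp_neg_le:
  fixes w :: complex
  assumes "0 \<le> Re w"
  shows "norm (1 - exp (- w)) \<le> norm w"
proof -
  have "norm (exp 0 - exp (- w)) \<le> 1 * norm (0 - (- w))"
  proof (rule field_differentiable_bound[where S = "{z. Re z \<le> 0}" and f' = exp])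
    show "convex {z. Re z \<le> 0}" by (rule convex_halfspace_Re_le)
  qed (use assms in \<open>auto intro!: derivative_eq_intros\<close>)
  then show ?thesis by simp
qed

lemma norm_one_minus_power_le:
  fixes u :: complex
  assumes "norm u \<le> 2"
  shows "norm (1 - u ^ N) \<le> 4 ^ N * norm (1 - u)"
proof -
  have "norm (\<Sum>i<N. u ^ i) \<le> (\<Sum>i<N. 2 ^ N)"
    using assms by (intro sum_norm_le) (auto simp: norm_power
        intro!: order_trans[OF power_mono[OF assms norm_ge_zero]] power_increasing)
  also have "\<dots> \<le> 2 ^ N * 2 ^ N"
    using of_nat_less_two_power[of N, where 'a = real] by simp
  also have "\<dots> = (4::real) ^ N"
    by (simp flip: power_mult_distrib)
  finally have "norm (\<Sum>i<N. u ^ i) \<le> 4 ^ N" .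
  then show ?thesis
    by (simp add: one_diff_power_eq norm_mult mult.commute[of "4 ^ N"] mult_left_mono)
qed

section \<open>Cut-off functions on the slit plane\<close>

definition root_kernel :: "real \<Rightarrow> complex \<Rightarrow> complex" where
  "root_kernel b z = inverse (csqrt (complex_of_real b * z))"

text \<open>The exponent \<open>2 p\<close> makes up for the square root: for large \<open>z\<close> the function decays like
  \<open>(b z)\<^bsup>-p\<^esup>\<close> and so cancels the growth of \<open>z\<^sup>p\<close>. For \<open>p = 0\<close> it is the constant 1.\<close>
definition cutoff :: "real \<Rightarrow> nat \<Rightarrow> complex \<Rightarrow> complex" where
  "cutoff b p z = (1 - exp (- root_kernel b z)) ^ (2 * p)"

lemma csqrt_of_real_mult:
  assumes "0 < b"
  shows "csqrt (complex_of_real b * z) = complex_of_real (sqrt b) * csqrt z"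
proof (rule csqrt_unique)
  show "(complex_of_real (sqrt b) * csqrt z)\<^sup>2 = complex_of_real b * z"
    using assms by (simp only: power_mult_distrib power2_csqrt of_real_power[symmetric]
        real_sqrt_pow2 less_imp_le)
  have *: "Re (complex_of_real s * w) = s * Re w" "Im (complex_of_real s * w) = s * Im w" for s w
    by simp_all
  show "0 < Re (complex_of_real (sqrt b) * csqrt z) \<or>
      Re (complex_of_real (sqrt b) * csqrt z) = 0 \<and> 0 \<le> Im (complex_of_real (sqrt b) * csqrt z)"
    unfolding * using csqrt_principal[of z] assms by (elim disjE) (simp_all del: csqrt.simps)
qed

lemma norm_root_kernel:
  assumes "0 < b"
  shows "norm (root_kernel b z) ^ 2 = inverse (b * norm z)"
  using assms by (simp add: root_kernel_def norm_inverse norm_mult power_inverse)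

lemma Re_root_kernel_ge:
  assumes "0 < b" "c * norm (csqrt z) \<le> Re (csqrt z)"
  shows "c * norm (root_kernel b z) \<le> Re (root_kernel b z)"
proof -
  define w where "w = csqrt (complex_of_real b * z)"
  have "sqrt b * (c * norm (csqrt z)) \<le> sqrt b * Re (csqrt z)"
    using assms by (intro mult_left_mono) auto
  then have "c * norm w \<le> Re w"
    unfolding w_def csqrt_of_real_mult[OF assms(1)] using assms(1)
    by (simp only: norm_mult) (simp add: mult_ac del: norm_csqrt)
  then have "c * norm w / norm w ^ 2 \<le> Re w / norm w ^ 2"
    by (rule divide_right_mono) simp
  then have "c * norm (inverse w) \<le> Re (inverse w)"
    by (cases "w = 0") (simp_all add: norm_inverse power2_eq_square[of "norm w"] divide_inverse
        flip: cmod_power2)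
  then show ?thesis by (simp add: root_kernel_def w_def)
qed

lemma Re_root_kernel_nonneg:
  assumes "0 < b"
  shows "0 \<le> Re (root_kernel b z)"
  using Re_root_kernel_ge[of b 0 z] assms Re_csqrt[of z] by simp

lemma holomorphic_on_cutoff:
  assumes "0 < b"
  shows "cutoff b p holomorphic_on - \<real>\<^sub>\<le>\<^sub>0"
proof -
  have "complex_of_real b * z \<notin> \<real>\<^sub>\<le>\<^sub>0 \<and> z \<noteq> 0" if "z \<in> - \<real>\<^sub>\<le>\<^sub>0" for z
    using that assms by (auto simp: complex_nonpos_Reals_iff mult_le_0_iff)
  then show ?thesis
    unfolding cutoff_def[abs_def] root_kernel_def using assms
    by (intro holomorphic_intros) auto
qed

lemma norm_one_minus_exp_root_kernel_le_2:
  assumes "0 < b"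
  shows "norm (1 - exp (- root_kernel b z)) \<le> 2"
proof -
  have "norm (1 - exp (- root_kernel b z)) \<le> norm (1 :: complex) + norm (exp (- root_kernel b z))"
    by (rule norm_triangle_ineq4)
  also have "\<dots> \<le> 2"
    using Re_root_kernel_nonneg[OF assms, of z] by simp
  finally show ?thesis .
qed

text \<open>The two bounds \<open>4\<^sup>p\<close> and \<open>(b |z|)\<^bsup>-p\<^esup>\<close> for the cut-off are used on either side of
  \<open>|z| = 1 / b\<close>; in both cases \<open>p - n\<close> factors \<open>|z|\<close> are traded for factors \<open>1 / b\<close>.\<close>
lemma norm_power_mult_cutoff_le:
  assumes "0 < b" "z \<noteq> 0" "n \<le> p"
  shows "norm z ^ p * norm (cutoff b p z) \<le> 4 ^ p * norm z ^ n / b ^ (p - n)"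
proof -
  let ?u = "1 - exp (- root_kernel b z)"
  have le4: "norm (cutoff b p z) \<le> 4 ^ p"
    using power_mono[OF norm_one_minus_exp_root_kernel_le_2[OF assms(1)] norm_ge_zero, of z "2 * p"]
    by (simp add: cutoff_def norm_power power_mult)
  have "norm ?u ^ 2 \<le> inverse (b * norm z)"
    unfolding norm_root_kernel[OF assms(1), symmetric]
    by (intro power_mono norm_one_minus_exp_neg_le Re_root_kernel_nonneg assms) auto
  then have leb: "norm (cutoff b p z) \<le> inverse (b * norm z) ^ p"
    unfolding cutoff_def norm_power power_mult by (rule power_mono) auto
  show ?thesis
  proof (cases "b * norm z \<le> 1")
    case True
    then have "norm z ^ (p - n) \<le> (1 / b) ^ (p - n)"
      using assms by (intro power_mono) (auto simp: field_simps)
    then have "norm z ^ n * norm z ^ (p - n) * norm (cutoff b p z)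
        \<le> norm z ^ n * (1 / b) ^ (p - n) * 4 ^ p"
      using le4 assms by (intro mult_mono) auto
    then show ?thesis
      using assms by (simp add: power_divide mult_ac flip: power_add)
  next
    case False
    have "norm z ^ p * norm (cutoff b p z) \<le> norm z ^ p * inverse (b * norm z) ^ p"
      using leb by (rule mult_left_mono) simp
    also have "\<dots> = (1 / b) ^ n * (1 / b) ^ (p - n)"
      using assms by (simp add: field_simps flip: power_add power_mult_distrib)
    also have "\<dots> \<le> norm z ^ n * (1 / b) ^ (p - n)"
      using False assms by (intro mult_right_mono power_mono) (auto simp: field_simps)
    also have "\<dots> \<le> 4 ^ p * (norm z ^ n * (1 / b) ^ (p - n))"
      using assms mult_right_mono[of 1 "4 ^ p" "norm z ^ n * (1 / b) ^ (p - n)"] by simp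
    finally show ?thesis by (simp add: power_divide mult_ac)
  qed
qed

text \<open>Flatness at 0, in the form of one estimate for every order \<open>k\<close>: it comes from the term of
  degree \<open>2 k\<close> in the exponential series of \<open>c |w|\<close>, where \<open>w\<close> is the value of the kernel.
  The constant \<open>c\<close> measures how far the direction of \<open>z\<close> is from the slit.\<close>
lemma norm_one_minus_cutoff_le:
  assumes "0 < b" "z \<noteq> 0" "0 < c" "c * norm (csqrt z) \<le> Re (csqrt z)"
  shows "norm (1 - cutoff b p z) \<le> 16 ^ p * (fact (2 * k) * (b * norm z / c\<^sup>2) ^ k)"
proof -
  let ?w = "root_kernel b z"
  have w: "0 < norm ?w"
    using assms by (simp add: root_kernel_def)
  have "(c * norm ?w) ^ (2 * k) / fact (2 * k) \<le> exp (c * norm ?w)"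
    using assms by (intro power_div_fact_le_exp) auto
  also have "\<dots> \<le> exp (Re ?w)"
    using Re_root_kernel_ge[OF assms(1,4)] by simp
  finally have "inverse (exp (Re ?w)) \<le> inverse ((c * norm ?w) ^ (2 * k) / fact (2 * k))"
    using w assms(3) by (intro le_imp_inverse_le) auto
  then have "exp (- Re ?w) \<le> fact (2 * k) / (c * norm ?w) ^ (2 * k)"
    by (simp only: exp_minus inverse_divide)
  also have "(c * norm ?w) ^ (2 * k) = ((c * norm ?w)\<^sup>2) ^ k"
    by (rule power_mult)
  also have "(c * norm ?w)\<^sup>2 = c\<^sup>2 / (b * norm z)"
    by (simp only: power_mult_distrib norm_root_kernel[OF assms(1)] divide_inverse)
  also have "fact (2 * k) / (c\<^sup>2 / (b * norm z)) ^ k = fact (2 * k) * (b * norm z / c\<^sup>2) ^ k"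
    by (simp add: power_divide)
  finally have e: "exp (- Re ?w) \<le> fact (2 * k) * (b * norm z / c\<^sup>2) ^ k" .
  have "norm (1 - cutoff b p z) \<le> 4 ^ (2 * p) * exp (- Re ?w)"
    using norm_one_minus_power_le[OF norm_one_minus_exp_root_kernel_le_2[OF assms(1)], of z "2 * p"]
    by (simp add: cutoff_def)
  also have "\<dots> \<le> 4 ^ (2 * p) * (fact (2 * k) * (b * norm z / c\<^sup>2) ^ k)"
    using e by (rule mult_left_mono) simp
  finally show ?thesis by (simp add: power_mult)
qed

section \<open>Proper subsectors of the slit plane\<close>

lemma proper_subsector_subset:
  assumes "unbounded_proper_subsector S T"
  shows "S \<subseteq> T" and "0 \<notin> S"
proof -
  show "0 \<notin> S"
    using assms by (auto simp: unbounded_proper_subsector_def unbounded_sector_def)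
  then show "S \<subseteq> T"
    using assms closure_subset[of S] by (auto simp: unbounded_proper_subsector_def)
qed

text \<open>The quotient \<open>Re (csqrt z) / |csqrt z|\<close> depends on the direction of \<open>z\<close> only. The directions
  in the closure of \<open>S\<close> form a compact set off the slit, on which this quotient is positive.\<close>
lemma proper_subsector_csqrt:
  assumes "unbounded_proper_subsector S (- \<real>\<^sub>\<le>\<^sub>0)"
  obtains c where "0 < c" "\<And>z. z \<in> S \<Longrightarrow> c * norm (csqrt z) \<le> Re (csqrt z)"
proof -
  define K where "K = closure S \<inter> sphere 0 1"
  have K: "K \<subseteq> - \<real>\<^sub>\<le>\<^sub>0"
    using assms by (auto simp: K_def unbounded_proper_subsector_def)
  have "compact K"
    unfolding K_def by (intro closed_Int_compact) auto
  have unit: "z /\<^sub>R norm z \<in> K" if "z \<in> S" for z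
  proof -
    from assms obtain a b where
      S: "S = {complex_of_real r * cis \<theta> | r \<theta>. 0 < r \<and> a < \<theta> \<and> \<theta> < b}"
      unfolding unbounded_proper_subsector_def unbounded_sector_def by blast
    from that obtain r \<theta> where z: "z = complex_of_real r * cis \<theta>" "0 < r" "a < \<theta>" "\<theta> < b"
      unfolding S by blast
    then have "z /\<^sub>R norm z = complex_of_real 1 * cis \<theta>"
      by (simp add: norm_mult scaleR_conv_of_real)
    moreover have "complex_of_real 1 * cis \<theta> \<in> S"
      unfolding S using z by (intro CollectI exI[of _ 1] exI[of _ \<theta>]) auto
    ultimately have "z /\<^sub>R norm z \<in> S" by simp
    moreover have "norm (z /\<^sub>R norm z) = 1"
      using z by simp
    ultimately show ?thesis
      using closure_subset[of S] by (auto simp: K_def)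
  qed
  have cont: "continuous_on K (\<lambda>z. Re (csqrt z))"
    using K by (intro continuous_intros continuous_on_subset[OF holomorphic_on_imp_continuous_on
          [OF holomorphic_on_csqrt]])
  have pos: "0 < Re (csqrt z)" if "z \<in> K" for z
  proof -
    have "Re (csqrt z) \<noteq> 0"
    proof
      assume "Re (csqrt z) = 0"
      then have "(csqrt z)\<^sup>2 \<in> \<real>\<^sub>\<le>\<^sub>0"
        unfolding complex_nonpos_Reals_iff power2_eq_square by (simp del: csqrt.simps)
      then have "z \<in> \<real>\<^sub>\<le>\<^sub>0" by simp
      then show False using K that by auto
    qed
    then show ?thesis using Re_csqrt[of z] by linarith
  qed
  have "\<exists>c>0. \<forall>z\<in>K. c \<le> Re (csqrt z)"
  proof (cases "K = {}")
    case False
    from continuous_attains_inf[OF \<open>compact K\<close> False cont] pos show ?thesis by blast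
  qed (auto intro: exI[of _ 1])
  then obtain c where c: "0 < c" "\<And>z. z \<in> K \<Longrightarrow> c \<le> Re (csqrt z)" by blast
  show ?thesis
  proof (rule that[OF c(1)])
    fix z assume z: "z \<in> S"
    then have nz: "0 < norm z"
      using proper_subsector_subset(2)[OF assms] by auto
    have "csqrt z = csqrt (complex_of_real (norm z) * (z /\<^sub>R norm z))"
      using nz by (simp add: scaleR_conv_of_real flip: mult.assoc)
    also have "\<dots> = complex_of_real (sqrt (norm z)) * csqrt (z /\<^sub>R norm z)"
      by (rule csqrt_of_real_mult[OF nz])
    finally have eq: "Re (csqrt z) = sqrt (norm z) * Re (csqrt (z /\<^sub>R norm z))"
      by simp
    have "c * norm (csqrt z) = sqrt (norm z) * c"
      by (simp only: norm_csqrt mult.commute)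
    also have "\<dots> \<le> sqrt (norm z) * Re (csqrt (z /\<^sub>R norm z))"
      by (rule mult_left_mono[OF c(2)[OF unit[OF z]]]) simp
    finally show "c * norm (csqrt z) \<le> Re (csqrt z)"
      by (simp only: eq)
  qed
qed

section \<open>The Ritt series\<close>

lemma fps_class_coeff_bound:
  assumes "F \<in> fps_class M" "\<And>p. 0 < M p"
  obtains L A where "0 < L" "0 < A" "\<And>p. norm (fps_nth F p) \<le> L * A ^ p * M p"
proof -
  from assms(1) obtain A L where A: "0 < A"
    and L: "\<And>p. norm (fps_nth F p) / (A ^ p * M p) \<le> L"
    unfolding fps_class_def bdd_above_def by auto
  show ?thesis
  proof (rule that[of "max L 1" A])
    fix p
    have "norm (fps_nth F p) \<le> L * (A ^ p * M p)"
      using L[of p] A assms(2)[of p] by (simp add: pos_divide_le_eq)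
    also have "\<dots> \<le> max L 1 * (A ^ p * M p)"
      using A less_imp_le[OF assms(2)[of p]] by (intro mult_right_mono) auto
    finally show "norm (fps_nth F p) \<le> max L 1 * A ^ p * M p" by (simp add: mult.assoc)
  qed (use A in auto)
qed

text \<open>By the condition \<open>tangent\<close>, the sequence \<open>ln M\<close> lies to the left of \<open>p\<close> above the line of slope
  \<open>ln (lam p)\<close> through its value at \<open>p\<close>; this bounds the terms of degree at least \<open>n\<close> by
  \<open>M n |z|\<^sup>n\<close> up to geometric factors. The condition \<open>growth\<close> asks for a
  quantitative convexity, strong enough to absorb the factorial that stems from the flatness of
  the cut-off functions; it controls the terms of degree less than \<open>n\<close>.\<close>
lemma borel_ritt_root_cutoff:
  fixes M lam :: "nat \<Rightarrow> real"
  assumes M: "\<And>p. 0 < M p" and lam: "\<And>p. 0 < lam p"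
    and tangent: "\<And>n p. n \<le> p \<Longrightarrow> M p \<le> M n * lam p ^ (p - n)"
    and growth: "\<And>p k. 0 < p \<Longrightarrow> fact (2 * k) * M p * lam p ^ k \<le> D ^ (p + k) * M (p + k)"
    and D: "0 < D"
    and F: "F \<in> fps_class M"
  shows "\<exists>f. f holomorphic_on (- \<real>\<^sub>\<le>\<^sub>0) \<and>
           (\<forall>S. unbounded_proper_subsector S (- \<real>\<^sub>\<le>\<^sub>0) \<longrightarrow>
                has_uniform_asymptotic_expansion M f F S)"
proof -
  obtain L A where L: "0 < L" and A: "0 < A"
    and coeff: "\<And>p. norm (fps_nth F p) \<le> L * A ^ p * M p"
    using fps_class_coeff_bound[OF F M] by blast
  \<comment> \<open>The factor \<open>4 A\<close> compensates for the geometric growth of the coefficients and for the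
    bound \<open>4\<^sup>p\<close> of the cut-off, the remaining factor 2 gives convergence.\<close>
  define B where "B = 8 * A"
  have B: "0 < B" using A by (simp add: B_def)
  have Bl: "0 < B * lam p" for p using B lam by simp
  define g where "g p z = fps_nth F p * z ^ p * cutoff (B * lam p) p z" for p z
  define f where "f z = (\<Sum>p. g p z)" for z
  have head: "norm (g p z) \<le> L * (B * norm z) ^ n * M n * (1 / 2) ^ p"
    if "n \<le> p" "z \<noteq> 0" for n p z
  proof -
    have "norm (g p z) = norm (fps_nth F p) * (norm z ^ p * norm (cutoff (B * lam p) p z))"
      by (simp add: g_def norm_mult norm_power)
    also have "\<dots> \<le> (L * A ^ p * M p) * (4 ^ p * norm z ^ n / (B * lam p) ^ (p - n))"
      using that by (intro mult_mono coeff norm_power_mult_cutoff_le Bl)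
        (auto intro!: mult_nonneg_nonneg zero_le_power less_imp_le[OF L] less_imp_le[OF A] less_imp_le[OF M])
    also have "\<dots> \<le> (L * A ^ p * (M n * lam p ^ (p - n))) * (4 ^ p * norm z ^ n / (B * lam p) ^ (p - n))"
      using L A less_imp_le[OF Bl, of p]
      by (intro mult_right_mono mult_left_mono tangent that) auto
    also have "\<dots> = L * (B * norm z) ^ n * M n * (4 * A / B) ^ p"
    proof -
      have Bp: "B ^ p = B ^ n * B ^ (p - n)"
        using that by (simp flip: power_add)
      have "lam p \<noteq> 0" "B \<noteq> 0"
        using lam[of p] B by auto
      then show ?thesis
        unfolding power_mult_distrib power_divide Bp by simp
    qed
    also have "4 * A / B = 1 / 2" using A by (simp add: B_def)
    finally show ?thesis .
  qed
  have geo: "summable (\<lambda>p. c * (1 / 2) ^ p :: real)" for c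
    by (intro summable_mult summable_geometric) auto
  have summ: "summable (\<lambda>p. g p z)" if "z \<noteq> 0" for z
    by (rule summable_comparison_test'[OF geo[of "L * M 0"]])
      (use head[of 0 _ z] that in simp)
  have hol: "f holomorphic_on - \<real>\<^sub>\<le>\<^sub>0"
  proof (rule holomorphic_uniform_sequence)
    show "open (- \<real>\<^sub>\<le>\<^sub>0 :: complex set)" by (simp add: open_Compl)
    show "(\<lambda>z. \<Sum>p<n. g p z) holomorphic_on - \<real>\<^sub>\<le>\<^sub>0" for n
      unfolding g_def by (intro holomorphic_intros holomorphic_on_cutoff Bl)
    have lim: "uniform_limit (- \<real>\<^sub>\<le>\<^sub>0) (\<lambda>n z. \<Sum>p<n. g p z) f sequentially"
      unfolding f_def
    proof (rule Weierstrass_m_test[OF _ geo[of "L * M 0"]])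
      fix p :: nat and z :: complex assume "z \<in> - \<real>\<^sub>\<le>\<^sub>0"
      then have "z \<noteq> 0" by auto
      then show "norm (g p z) \<le> L * M 0 * (1 / 2) ^ p"
        using head[of 0 p z] by simp
    qed
    fix z :: complex assume "z \<in> - \<real>\<^sub>\<le>\<^sub>0"
    then obtain d where "0 < d" "cball z d \<subseteq> - \<real>\<^sub>\<le>\<^sub>0"
      using open_contains_cball[of "- \<real>\<^sub>\<le>\<^sub>0 :: complex set"] by (auto simp: open_Compl)
    then show "\<exists>d>0. cball z d \<subseteq> - \<real>\<^sub>\<le>\<^sub>0 \<and>
        uniform_limit (cball z d) (\<lambda>n z. \<Sum>p<n. g p z) f sequentially"
      using uniform_limit_on_subset[OF lim] by blast
  qed
  moreover have "has_uniform_asymptotic_expansion M f F S"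
    if S: "unbounded_proper_subsector S (- \<real>\<^sub>\<le>\<^sub>0)" for S
  proof -
    obtain c where c: "0 < c" "\<And>z. z \<in> S \<Longrightarrow> c * norm (csqrt z) \<le> Re (csqrt z)"
      using proper_subsector_csqrt[OF S] by blast
    \<comment> \<open>\<open>Q\<close> dominates both the factor \<open>16 A\<close>, which occurs \<open>p\<close> times in the bound for the \<open>p\<close>-th
      error term, and the factor \<open>B / c\<^sup>2\<close>, which occurs \<open>n - p\<close> times.\<close>
    define Q where "Q = 16 * A + B / c\<^sup>2"
    have Q: "0 < Q" "16 * A \<le> Q" "B / c\<^sup>2 \<le> Q"
      using A B c(1) by (auto simp: Q_def add_pos_nonneg)
    have tail: "norm (g p z - fps_nth F p * z ^ p) \<le> L * (Q * D * norm z) ^ n * M n"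
      if "p < n" "z \<in> S" for p n z
    proof (cases "p = 0")
      case True
      then show ?thesis
        using L Q(1) D M[of n] by (simp add: g_def cutoff_def)
    next
      case False
      define k where "k = n - p"
      have n: "n = p + k" using that by (simp add: k_def)
      have z: "z \<noteq> 0" using that proper_subsector_subset(2)[OF S] by auto
      let ?\<chi> = "cutoff (B * lam p) p z"
      have "g p z - fps_nth F p * z ^ p = - (fps_nth F p * (z ^ p * (1 - ?\<chi>)))"
        by (simp add: g_def algebra_simps)
      then have "norm (g p z - fps_nth F p * z ^ p) = norm (fps_nth F p) * (norm z ^ p * norm (1 - ?\<chi>))"
        by (simp add: norm_mult norm_power)
      also have "\<dots> \<le> (L * A ^ p * M p) *
          (norm z ^ p * (16 ^ p * (fact (2 * k) * (B * lam p * norm z / c\<^sup>2) ^ k)))"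
        using that
        by (intro mult_mono mult_left_mono coeff norm_one_minus_cutoff_le Bl z c)
          (auto intro!: mult_nonneg_nonneg zero_le_power less_imp_le[OF L] less_imp_le[OF A] less_imp_le[OF M])
      also have "\<dots> = L * norm z ^ n * ((16 * A) ^ p * (B / c\<^sup>2) ^ k) * (fact (2 * k) * M p * lam p ^ k)"
        by (simp add: n power_add power_mult_distrib power_divide mult_ac)
      also have "\<dots> \<le> L * norm z ^ n * (Q ^ p * Q ^ k) * (D ^ (p + k) * M (p + k))"
        using False L Q A B less_imp_le[OF M] less_imp_le[OF lam]
        by (intro mult_mono mult_left_mono growth power_mono) auto
      also have "\<dots> = L * (Q * D * norm z) ^ n * M n"
        by (simp add: n power_add power_mult_distrib mult_ac)
      finally show ?thesis .
    qed
    \<comment> \<open>The extra factor 2 absorbs the number \<open>n\<close> of error terms, since \<open>n \<le> 2\<^sup>n\<close>.\<close>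
    define E where "E = B + 2 * Q * D"
    have QD: "0 < Q * D" using Q D by simp
    have E: "0 < E" "B \<le> E" "2 * Q * D \<le> E"
      using B QD unfolding E_def mult.assoc by linarith+
    have "norm (f z - (\<Sum>p<n. fps_nth F p * z ^ p)) \<le> 3 * L * E ^ n * M n * norm z ^ n"
      if z: "z \<in> S" for n z
    proof -
      have nz: "z \<noteq> 0" using z proper_subsector_subset(2)[OF S] by auto
      have "f z - (\<Sum>p<n. fps_nth F p * z ^ p)
          = (\<Sum>p. g (p + n) z) + (\<Sum>p<n. g p z - fps_nth F p * z ^ p)"
        unfolding f_def suminf_split_initial_segment[OF summ[OF nz], of n]
        by (simp add: sum_subtractf)
      moreover have "norm (\<Sum>p. g (p + n) z) \<le> 2 * L * E ^ n * M n * norm z ^ n"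
      proof -
        let ?K = "L * (B * norm z) ^ n * M n"
        have "norm (g (p + n) z) \<le> ?K * (1 / 2) ^ p" for p
        proof -
          have "norm (g (p + n) z) \<le> ?K * (1 / 2) ^ (p + n)"
            using head[OF _ nz, of n "p + n"] by simp
          also have "\<dots> \<le> ?K * (1 / 2) ^ p"
            using L B M[of n] by (intro mult_left_mono power_decreasing) auto
          finally show ?thesis .
        qed
        then have "norm (\<Sum>p. g (p + n) z) \<le> (\<Sum>p. ?K * (1 / 2) ^ p)"
          by (rule norm_suminf_le[OF _ geo])
        also have "\<dots> = 2 * ?K"
          by (subst suminf_mult) (auto simp: suminf_geometric)
        also have "\<dots> = 2 * (L * norm z ^ n * M n) * B ^ n"
          by (simp add: power_mult_distrib mult_ac)
        also have "\<dots> \<le> 2 * (L * norm z ^ n * M n) * E ^ n"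
          using L B E M[of n] by (intro mult_left_mono power_mono) auto
        finally show ?thesis by (simp add: mult_ac)
      qed
      moreover have "norm (\<Sum>p<n. g p z - fps_nth F p * z ^ p) \<le> L * E ^ n * M n * norm z ^ n"
      proof -
        let ?K = "L * (Q * D * norm z) ^ n * M n"
        have K: "0 \<le> ?K" using L QD M[of n] by simp
        have "norm (\<Sum>p<n. g p z - fps_nth F p * z ^ p) \<le> (\<Sum>p<n. ?K)"
          using z by (intro sum_norm_le tail) auto
        also have "\<dots> \<le> 2 ^ n * ?K"
          using of_nat_less_two_power[of n, where 'a = real] K by (simp add: mult_right_mono)
        also have "\<dots> = (L * norm z ^ n * M n) * (2 * Q * D) ^ n"
          by (simp add: power_mult_distrib mult_ac)
        also have "\<dots> \<le> (L * norm z ^ n * M n) * E ^ n"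
          using L Q(1) D E M[of n] by (intro mult_left_mono power_mono) auto
        finally show ?thesis by (simp add: mult_ac)
      qed
      ultimately show ?thesis
        using norm_triangle_ineq[of "\<Sum>p. g (p + n) z" "\<Sum>p<n. g p z - fps_nth F p * z ^ p"]
        by simp
    qed
    moreover have "f holomorphic_on S"
      using hol proper_subsector_subset(1)[OF S] by (rule holomorphic_on_subset)
    ultimately show ?thesis
      unfolding has_uniform_asymptotic_expansion_def using L E(1)
      by (intro conjI exI[of _ "3 * L"] exI[of _ E]) auto
  qed
  ultimately show ?thesis by blast
qed

section \<open>Convexity of the weight sequence\<close>

definition phi :: "real \<Rightarrow> real \<Rightarrow> real \<Rightarrow> real" where
  "phi \<tau> \<sigma> t = \<tau> * (t powr \<sigma> * ln t)"

definition phi' :: "real \<Rightarrow> real \<Rightarrow> real \<Rightarrow> real" where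
  "phi' \<tau> \<sigma> t = \<tau> * (t powr (\<sigma> - 1) * (\<sigma> * ln t + 1))"

definition phi'' :: "real \<Rightarrow> real \<Rightarrow> real \<Rightarrow> real" where
  "phi'' \<tau> \<sigma> t = \<tau> * (t powr (\<sigma> - 2) * ((\<sigma> - 1) * (\<sigma> * ln t + 1) + \<sigma>))"

text \<open>The convention \<open>ln 0 = 0\<close> makes this true at \<open>p = 0\<close> as well.\<close>
lemma M_seq_eq_exp_phi: "M_seq \<tau> \<sigma> p = exp (phi \<tau> \<sigma> (real p))"
  by (simp add: M_seq_def phi_def powr_def mult_ac)

lemma has_derivative_phi:
  assumes "0 < t"
  shows "(phi \<tau> \<sigma> has_real_derivative phi' \<tau> \<sigma> t) (at t)"
proof -
  have "t powr \<sigma> = t * t powr (\<sigma> - 1)"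
    using assms by (simp add: powr_diff)
  then show ?thesis
    unfolding phi_def[abs_def] phi'_def using assms
    by (auto intro!: derivative_eq_intros simp: field_simps)
qed

lemma has_derivative_phi':
  assumes "0 < t"
  shows "(phi' \<tau> \<sigma> has_real_derivative phi'' \<tau> \<sigma> t) (at t)"
proof -
  have "t powr (\<sigma> - 1) = t * t powr (\<sigma> - 2)"
    using assms by (simp add: powr_diff power2_eq_square)
  moreover have "\<sigma> - 1 - 1 = \<sigma> - 2" by simp
  ultimately show ?thesis
    unfolding phi'_def[abs_def] phi''_def using assms
    by (auto intro!: derivative_eq_intros simp: field_simps)
qed

text \<open>The exponent \<open>\<sigma> - 2\<close> is not positive, so the power is smallest at the right end of \<open>[1, N]\<close>;
  the other factor is at least \<open>\<sigma>\<close>.\<close>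
lemma phi''_lower_bound:
  assumes "0 < \<tau>" "1 \<le> \<sigma>" "\<sigma> \<le> 2" "1 \<le> t" "t \<le> N"
  shows "\<tau> * N powr (\<sigma> - 2) \<le> phi'' \<tau> \<sigma> t"
proof -
  have "N powr (\<sigma> - 2) * 1 \<le> t powr (\<sigma> - 2) * ((\<sigma> - 1) * (\<sigma> * ln t + 1) + \<sigma>)"
  proof (rule mult_mono)
    show "N powr (\<sigma> - 2) \<le> t powr (\<sigma> - 2)"
      using assms by (intro powr_mono2') auto
    have "0 \<le> (\<sigma> - 1) * (\<sigma> * ln t + 1)"
      using assms by simp
    then show "1 \<le> (\<sigma> - 1) * (\<sigma> * ln t + 1) + \<sigma>"
      using assms by linarith
  qed auto
  then show ?thesis
    unfolding phi''_def using assms by simp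
qed

lemma phi_above_tangent:
  assumes "0 < \<tau>" "1 \<le> \<sigma>" "\<sigma> \<le> 2" "1 \<le> s" "s \<le> N" "1 \<le> t" "t \<le> N"
  shows "phi \<tau> \<sigma> s + phi' \<tau> \<sigma> s * (t - s) + \<tau> * N powr (\<sigma> - 2) / 2 * (t - s)\<^sup>2 \<le> phi \<tau> \<sigma> t"
proof (cases "t = s")
  case False
  define diff where "diff m = (if m = 0 then phi \<tau> \<sigma> else if m = 1 then phi' \<tau> \<sigma> else phi'' \<tau> \<sigma>)"
    for m :: nat
  have "\<forall>m x. m < 2 \<and> 1 \<le> x \<and> x \<le> N \<longrightarrow> DERIV (diff m) x :> diff (Suc m) x"
    by (auto simp: diff_def less_2_cases_iff has_derivative_phi has_derivative_phi')
  then obtain x where x: "if t < s then t < x \<and> x < s else s < x \<and> x < t"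
    and eq: "phi \<tau> \<sigma> t = (\<Sum>m<2. diff m s / fact m * (t - s) ^ m) + diff 2 x / fact 2 * (t - s)\<^sup>2"
    using Taylor[of 2 diff "phi \<tau> \<sigma>" 1 N s t] assms False by (auto simp: diff_def)
  have "\<tau> * N powr (\<sigma> - 2) \<le> phi'' \<tau> \<sigma> x"
    using x assms by (intro phi''_lower_bound) (auto split: if_splits)
  then have "\<tau> * N powr (\<sigma> - 2) / 2 * (t - s)\<^sup>2 \<le> phi'' \<tau> \<sigma> x / 2 * (t - s)\<^sup>2"
    by (intro mult_right_mono) auto
  moreover have "phi \<tau> \<sigma> t = phi \<tau> \<sigma> s + phi' \<tau> \<sigma> s * (t - s) + phi'' \<tau> \<sigma> x / 2 * (t - s)\<^sup>2"
    using eq by (simp add: diff_def numeral_2_eq_2)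
  ultimately show ?thesis by linarith
qed simp

text \<open>Between positive integers this is convexity. Near 0 the function \<open>\<phi>\<close> need not be convex, so the
  value \<open>n = 0\<close> needs the direct computation
  \<open>p \<phi>' p - \<phi> p = \<tau> p\<^sup>\<sigma> ((\<sigma> - 1) ln p + 1) \<ge> 0\<close>.\<close>
lemma M_seq_tangent:
  assumes "0 < \<tau>" "1 \<le> \<sigma>" "\<sigma> \<le> 2" "n \<le> p"
  shows "M_seq \<tau> \<sigma> p \<le> M_seq \<tau> \<sigma> n * exp (phi' \<tau> \<sigma> (real p)) ^ (p - n)"
proof -
  have "phi \<tau> \<sigma> (real p) \<le> phi \<tau> \<sigma> (real n) + phi' \<tau> \<sigma> (real p) * (real p - real n)"
  proof (cases "p = 0 \<or> n = 0")
    case False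
    then have "0 \<le> \<tau> * real p powr (\<sigma> - 2) / 2 * (real n - real p)\<^sup>2"
      using assms by simp
    then show ?thesis
      using phi_above_tangent[of \<tau> \<sigma> "real p" "real p" "real n"] False assms
      unfolding right_diff_distrib by linarith
  next
    case True
    show ?thesis
    proof (cases "p = 0")
      case True
      then show ?thesis using assms by simp
    next
      case False
      then have p: "1 \<le> real p" and n: "n = 0" using True by auto
      have "real p powr \<sigma> = real p powr (\<sigma> - 1) * real p"
        using p by (simp add: powr_diff)
      then have "phi' \<tau> \<sigma> (real p) * real p - phi \<tau> \<sigma> (real p)
          = \<tau> * (real p powr \<sigma> * ((\<sigma> - 1) * ln (real p) + 1))"
        by (simp add: phi_def phi'_def algebra_simps)
      also have "\<dots> \<ge> 0" using assms p by simp
      finally show ?thesis using n by (simp add: phi_def)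
    qed
  qed
  then show ?thesis
    using assms by (simp add: M_seq_eq_exp_phi mult_ac of_nat_diff flip: exp_of_nat_mult exp_add)
qed

text \<open>With \<open>n = p + k\<close>, the factorial is at most \<open>exp (2 k ln (2 n))\<close>. The inequality of arithmetic
  and geometric means splits this exponent into the quadratic gain \<open>m k\<^sup>2\<close> of
  \<open>phi_above_tangent\<close> and \<open>(ln (2 n))\<^sup>2 / m\<close>, which is at most of order \<open>n\<close>.\<close>
lemma M_seq_growth:
  assumes "0 < \<tau>" "1 < \<sigma>" "\<sigma> \<le> 2" "0 < p"
  shows "fact (2 * k) * M_seq \<tau> \<sigma> p * exp (phi' \<tau> \<sigma> (real p)) ^ k
    \<le> exp (16 / (\<tau> * (\<sigma> - 1)\<^sup>2)) ^ (p + k) * M_seq \<tau> \<sigma> (p + k)"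
proof -
  define n a l where "n = real (p + k)" and "a = (\<sigma> - 1) / 2" and "l = ln (2 * n)"
  have n: "1 \<le> n" "real p \<le> n" "real k \<le> n" using assms by (auto simp: n_def)
  have a: "0 < a" using assms by (simp add: a_def)
  have fac: "fact (2 * k) \<le> exp (2 * real k * l)"
  proof -
    have "(fact (2 * k) :: real) \<le> of_nat ((2 * k) ^ (2 * k))"
      by (rule fact_le_power)
    also have "\<dots> = (2 * real k) ^ (2 * k)" by simp
    also have "\<dots> \<le> (2 * n) ^ (2 * k)"
      using n by (intro power_mono) auto
    also have "\<dots> = exp (2 * real k * l)"
      using n exp_of_nat_mult[of "2 * k" l] by (simp add: l_def)
    finally show ?thesis .
  qed
  \<comment> \<open>The exponent \<open>a = (\<sigma> - 1) / 2\<close> is such that \<open>l\<^sup>2\<close> grows at most like \<open>n\<^bsup>\<sigma>-1\<^esup>\<close>, which together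
    with \<open>1 / m\<close>, of order \<open>n\<^bsup>2-\<sigma>\<^esup>\<close>, gives \<open>n\<close>.\<close>
  have "l \<le> (2 * n) powr a / a"
    unfolding l_def using n a by (intro ln_powr_bound) auto
  then have "l\<^sup>2 \<le> ((2 * n) powr a / a)\<^sup>2"
    using n by (intro power_mono) (auto simp: l_def)
  also have "\<dots> = (2 * n) powr (\<sigma> - 1) / a\<^sup>2"
    by (simp add: power_divide power2_eq_square a_def flip: powr_add)
  also have "\<dots> \<le> 2 * n powr (\<sigma> - 1) / a\<^sup>2"
  proof -
    have "(2::real) powr (\<sigma> - 1) \<le> 2 powr 1" using assms by (intro powr_mono) auto
    then show ?thesis using n by (intro divide_right_mono) (auto simp: powr_mult mult_right_mono)
  qed
  finally have l2: "l\<^sup>2 \<le> 2 * n powr (\<sigma> - 1) / a\<^sup>2" .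
  define m where "m = \<tau> * n powr (\<sigma> - 2) / 2"
  have m: "0 < m" using assms n by (simp add: m_def)
  have "2 * real k * l \<le> m * (real k)\<^sup>2 + l\<^sup>2 / m"
  proof -
    have "0 \<le> (m * real k - l)\<^sup>2 / m" using m by simp
    also have "\<dots> = m * (real k)\<^sup>2 - 2 * real k * l + l\<^sup>2 / m"
      using m by (simp add: power2_eq_square field_simps)
    finally show ?thesis by simp
  qed
  also have "l\<^sup>2 / m \<le> 2 * n powr (\<sigma> - 1) / a\<^sup>2 / m"
    using l2 m by (intro divide_right_mono) auto
  also have "\<dots> = 16 / (\<tau> * (\<sigma> - 1)\<^sup>2) * n"
  proof -
    have eq: "n powr (\<sigma> - 1) = n * n powr (\<sigma> - 2)"
      using n by (simp add: powr_diff power2_eq_square)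
    have frac: "2 * (n * y) / (u / 2)\<^sup>2 / (\<tau> * y / 2) = 16 / (\<tau> * u\<^sup>2) * n"
      if "y \<noteq> 0" "u \<noteq> 0" for y u :: real
      using that assms(1) by (simp add: power2_eq_square)
    show ?thesis
      unfolding m_def a_def eq by (rule frac) (use n assms in auto)
  qed
  finally have "2 * real k * l \<le> m * (real k)\<^sup>2 + 16 / (\<tau> * (\<sigma> - 1)\<^sup>2) * n"
    by simp
  moreover have "phi \<tau> \<sigma> (real p) + phi' \<tau> \<sigma> (real p) * real k + m * (real k)\<^sup>2 \<le> phi \<tau> \<sigma> n"
    using phi_above_tangent[of \<tau> \<sigma> "real p" n n] assms n by (simp add: n_def m_def)
  ultimately have *: "2 * real k * l + phi \<tau> \<sigma> (real p) + phi' \<tau> \<sigma> (real p) * real k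
      \<le> 16 / (\<tau> * (\<sigma> - 1)\<^sup>2) * n + phi \<tau> \<sigma> n"
    by linarith
  have "fact (2 * k) * M_seq \<tau> \<sigma> p * exp (phi' \<tau> \<sigma> (real p)) ^ k
      \<le> exp (2 * real k * l) * M_seq \<tau> \<sigma> p * exp (phi' \<tau> \<sigma> (real p)) ^ k"
    by (intro mult_right_mono fac) (auto simp: M_seq_eq_exp_phi)
  also have "\<dots> = exp (2 * real k * l + phi \<tau> \<sigma> (real p) + phi' \<tau> \<sigma> (real p) * real k)"
    unfolding M_seq_eq_exp_phi exp_add by (simp add: exp_of_nat2_mult)
  also have "\<dots> \<le> exp (16 / (\<tau> * (\<sigma> - 1)\<^sup>2) * n + phi \<tau> \<sigma> n)"
    using * by simp
  also have "\<dots> = exp (16 / (\<tau> * (\<sigma> - 1)\<^sup>2)) ^ (p + k) * M_seq \<tau> \<sigma> (p + k)"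
    unfolding M_seq_eq_exp_phi exp_add n_def exp_of_nat2_mult ..
  finally show ?thesis .
qed

theorem theorem5p1:
  fixes \<tau> \<sigma> :: real and F :: "complex fps"
  assumes "\<tau> > 0" and "1 < \<sigma>" and "\<sigma> < 2"
    and "F \<in> fps_class (M_seq \<tau> \<sigma>)"
  shows "\<exists>f. f holomorphic_on (- \<real>\<^sub>\<le>\<^sub>0) \<and>
           (\<forall>S. unbounded_proper_subsector S (- \<real>\<^sub>\<le>\<^sub>0) \<longrightarrow>
                has_uniform_asymptotic_expansion (M_seq \<tau> \<sigma>) f F S)"
proof (rule borel_ritt_root_cutoff)
  show "M_seq \<tau> \<sigma> p \<le> M_seq \<tau> \<sigma> n * exp (phi' \<tau> \<sigma> (real p)) ^ (p - n)" if "n \<le> p" for n p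
    using M_seq_tangent that assms by simp
  show "fact (2 * k) * M_seq \<tau> \<sigma> p * exp (phi' \<tau> \<sigma> (real p)) ^ k
    \<le> exp (16 / (\<tau> * (\<sigma> - 1)\<^sup>2)) ^ (p + k) * M_seq \<tau> \<sigma> (p + k)" if "0 < p" for p k
    using M_seq_growth that assms by simp
qed (use assms in \<open>auto simp: M_seq_eq_exp_phi\<close>)

end
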